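(* Let $\delta \in (0,1)$ and $c = \frac{9}{2 \ln \frac{2}{\delta}}$. Let $Z$ be a real random variable with $\Pr\{0 \leq Z \leq 1\} = 1$ and mean $\mu = \mathbb{E}(Z)$. Let $\overline{Z} = \frac{\sum_{i=1}^n Z_i}{n}$, where $n$ is the sample size (a positive integer) and $Z_1, \ldots, Z_n$ are i.i.d. observations of $Z$ (i.e. independent random variables each with the same distribution as $Z$). Define $$L = \overline{Z} + \frac{3}{4 + n c} \left[ 1 - 2 \overline{Z} - \sqrt{ 1 + n c\, \overline{Z} (1 - \overline{Z}) } \right],$$ $$U = \overline{Z} + \frac{3}{4 + n c} \left[ 1 - 2 \overline{Z} + \sqrt{ 1 + n c\, \overline{Z} (1 - \overline{Z}) } \right].$$ Then $\Pr \{ L < \mu < U \} \geq 1 - \delta$.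
   Formalization: The formal theorem additionally assumes 0 < μ < 1: if μ = 0 then L = 0 = μ almost surely, and if μ = 1 then U = 1 = μ almost surely, so Pr{L < μ < U} = 0 and the claim fails in exactly these two cases. *)

theory Defs
  imports "HOL-Probability.Probability"
begin

definition ci_const :: "real \<Rightarrow> real" where
  "ci_const \<delta> = 9 / (2 * ln (2 / \<delta>))"

definition sample_mean :: "nat \<Rightarrow> (nat \<Rightarrow> 'a \<Rightarrow> real) \<Rightarrow> 'a \<Rightarrow> real" where
  "sample_mean n X \<omega> = (\<Sum>i = 1..n. X i \<omega>) / real n"

text \<open>The confidence limits as functions of the observed sample mean \<open>z\<close>. The radicand is
  at least 1 for \<open>z\<close> in the unit interval, so the convention for \<open>sqrt\<close> of a negative number
  matters only on a null set.\<close>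

definition lower_limit :: "real \<Rightarrow> nat \<Rightarrow> real \<Rightarrow> real" where
  "lower_limit \<delta> n z =
     z + 3 / (4 + real n * ci_const \<delta>) *
       (1 - 2 * z - sqrt (1 + real n * ci_const \<delta> * z * (1 - z)))"

definition upper_limit :: "real \<Rightarrow> nat \<Rightarrow> real \<Rightarrow> real" where
  "upper_limit \<delta> n z =
     z + 3 / (4 + real n * ci_const \<delta>) *
       (1 - 2 * z + sqrt (1 + real n * ci_const \<delta> * z * (1 - z)))"

end

theory Submission
  imports Defs
begin

text \<open>
  The limits \<open>L\<close> and \<open>U\<close> are the roots in \<open>\<mu>\<close> of the quadratic equation
  \<open>n (z - \<mu>)\<^sup>2 / (2 w (1 - w)) = ln (2 / \<delta>)\<close> with \<open>w = (2 \<mu> + z) / 3\<close>, so the claim reduces to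
  Massart's form of the Chernoff--Hoeffding bound, in which the Kullback--Leibler divergence of
  \<open>z\<close> from \<open>\<mu>\<close> is bounded below by \<open>(z - \<mu>)\<^sup>2 / (2 w (1 - w))\<close>. The divergence is the integral of
  \<open>(z - x) / (x (1 - x))\<close> over \<open>x\<close> from \<open>\<mu>\<close> to \<open>z\<close>; the weight \<open>z - x\<close> has total mass \<open>(z - \<mu>)\<^sup>2 / 2\<close> and
  barycentre \<open>w\<close>, so the bound is Jensen's inequality for the convex function \<open>1 / (x (1 - x))\<close>.
  The lower tail is the upper tail of \<open>1 - X\<close>.
\<close>

section \<open>Massart's lower bound for the divergence\<close>

definition massart :: "real \<Rightarrow> real \<Rightarrow> real" where
  "massart \<mu> z = (z - \<mu>)\<^sup>2 / (2 * ((2 * \<mu> + z) / 3 * (1 - (2 * \<mu> + z) / 3)))"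

lemma massart_flip: "massart (1 - \<mu>) (1 - z) = massart \<mu> z"
proof -
  define w where "w = (2 * \<mu> + z) / 3"
  have w: "(2 * (1 - \<mu>) + (1 - z)) / 3 = 1 - w" by (simp add: w_def field_simps)
  have sq: "(1 - z - (1 - \<mu>))\<^sup>2 = (z - \<mu>)\<^sup>2"
    by (simp add: power2_eq_square algebra_simps)
  show ?thesis
    unfolding massart_def w sq w_def[symmetric] by (simp add: mult.commute)
qed

text \<open>For \<open>z\<close> in the interval, \<open>(2 * \<mu> + z) / 3\<close> stays strictly
  between 0 and 1, so the denominator does not vanish. Continuity makes the set \<open>S\<close> in
  \<open>massart_deviation\<close> closed.\<close>

lemma continuous_on_massart:
  assumes "0 < \<mu>" "\<mu> < 1"
  shows "continuous_on {\<mu>..1} (massart \<mu>)"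
  unfolding massart_def using assms by (intro continuous_intros) auto

text \<open>The two sides differ by a square over a positive number. Used at \<open>x\<close> and at
  \<open>1 - x\<close>, this gives the supporting line for Jensen's inequality.\<close>

lemma inverse_ge_tangent:
  fixes x w :: real
  assumes "0 < x" "0 < w"
  shows "1 / x \<ge> 1 / w - (x - w) / w\<^sup>2"
proof -
  have "1 / x - (1 / w - (x - w) / w\<^sup>2) = (x - w)\<^sup>2 / (x * w\<^sup>2)"
    using assms by (simp add: field_simps power2_eq_square)
  also have "\<dots> \<ge> 0" using assms by simp
  finally show ?thesis by simp
qed

lemma kl_ge_massart:
  assumes \<mu>: "0 < \<mu>" "\<mu> < z" and z: "z < 1"
  shows "massart \<mu> z \<le> z * ln (z / \<mu>) + (1 - z) * ln ((1 - z) / (1 - \<mu>))"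
proof -
  define w where "w = (2 * \<mu> + z) / 3"
  have w: "0 < w" "w < 1" using assms by (auto simp: w_def)
  define a where "a = 1 / w + 1 / (1 - w)"
  define b where "b = 1 / (1 - w)\<^sup>2 - 1 / w\<^sup>2"
  \<comment> \<open>\<open>a + b * (x - w)\<close> is the tangent at \<open>w\<close> of \<open>1 / x + 1 / (1 - x)\<close>; the last summand of \<open>F x\<close> is
    minus the integral of \<open>(z - y) * (a + b * (y - w))\<close> over \<open>y\<close> from \<open>x\<close> to \<open>z\<close>.\<close>
  define F where "F x = z * (ln z - ln x) + (1 - z) * (ln (1 - z) - ln (1 - x))
    - (a * (z - x)\<^sup>2 / 2 + b * ((z - w) * (z - x)\<^sup>2 / 2 - (z - x)^3 / 3))" for x
  \<comment> \<open>The derivative of \<open>F\<close> is \<open>- (z - x)\<close> times the gap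
    between the convex function and its tangent, and \<open>F z = 0\<close>, so
    \<open>F \<mu>\<close> is nonnegative.\<close>
  have "F z \<le> F \<mu>"
  proof (rule DERIV_nonpos_imp_nonincreasing[where f = F and a = \<mu> and b = z])
    show "\<mu> \<le> z" using \<mu> by simp
    fix x assume x: "\<mu> \<le> x" "x \<le> z"
    have "(F has_real_derivative - (z - x) * (1 / x + 1 / (1 - x) - (a + b * (x - w)))) (at x)"
      unfolding F_def using x assms
      by (auto intro!: derivative_eq_intros) (simp add: field_simps power2_eq_square)
    moreover have "a + b * (x - w) \<le> 1 / x + 1 / (1 - x)"
    proof -
      have "1 / x \<ge> 1 / w - (x - w) / w\<^sup>2"
        using x assms w by (intro inverse_ge_tangent) auto
      moreover have "1 / (1 - x) \<ge> 1 / (1 - w) - ((1 - x) - (1 - w)) / (1 - w)\<^sup>2"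
        using x assms w by (intro inverse_ge_tangent) auto
      ultimately show ?thesis by (simp add: a_def b_def left_diff_distrib diff_divide_distrib)
    qed
    ultimately show "\<exists>y. (F has_real_derivative y) (at x) \<and> y \<le> 0"
      using x by (smt (verit) mult_nonneg_nonneg mult_minus_left)
  qed
  moreover have "F z = 0" by (simp add: F_def)
  moreover have "massart \<mu> z = a * (z - \<mu>)\<^sup>2 / 2"
  proof -
    have "a = 1 / (w * (1 - w))" using w by (simp add: a_def field_simps)
    then show ?thesis unfolding massart_def w_def[symmetric] by simp
  qed
  \<comment> \<open>The coefficient of \<open>b\<close> in \<open>F \<mu>\<close> is the first
    moment of the weight \<open>z - y\<close> about its barycentre \<open>w\<close>, so only the
    term in \<open>a\<close> survives.\<close>
  moreover have "(z - w) * (z - \<mu>)\<^sup>2 / 2 - (z - \<mu>)^3 / 3 = 0"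
    by (simp add: w_def power2_eq_square power3_eq_cube field_simps)
  ultimately show ?thesis using assms by (simp add: F_def ln_div)
qed

section \<open>Chord bound for \<open>exp\<close>, and the quadratic inequality behind the
  limits\<close>

lemma exp_le_chord:
  fixes l x :: real
  assumes "0 \<le> x" "x \<le> 1"
  shows "exp (l * x) \<le> 1 - x + x * exp l"
  using convex_onD[OF exp_convex, of x 0 l] assms by (simp add: mult.commute)

text \<open>Cleared of denominators, \<open>V\<close> is a quadratic inequality in
  \<open>\<mu>\<close> with leading coefficient \<open>4 + k\<close>. Completing the square places
  \<open>(4 + k) * (\<mu> - z)\<close> within \<open>3 * D\<close> of
  \<open>3 * (1 - 2 * z)\<close>. In the application \<open>k\<close> is
  \<open>n * ci_const \<delta>\<close>.\<close>

lemma limits_contain: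
  fixes k \<mu> z :: real
  assumes k: "0 < k" and z: "0 \<le> z" "z \<le> 1" and \<mu>: "0 < \<mu>" "\<mu> < 1"
    and V: "massart \<mu> z < 9 / (2 * k)"
  shows "z + 3 / (4 + k) * (1 - 2 * z - sqrt (1 + k * z * (1 - z))) < \<mu>"
    and "\<mu> < z + 3 / (4 + k) * (1 - 2 * z + sqrt (1 + k * z * (1 - z)))"
proof -
  define D where "D = sqrt (1 + k * z * (1 - z))"
  have D2: "D\<^sup>2 = 1 + k * z * (1 - z)" and D0: "0 \<le> D" using k z by (simp_all add: D_def)
  \<comment> \<open>With \<open>w = (2 * \<mu> + z) / 3\<close>, \<open>p\<close> equals
    \<open>9 * w * (1 - w)\<close>.\<close>
  define p where "p = (2 * \<mu> + z) * (3 - 2 * \<mu> - z)"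
  have p: "0 < p" using z \<mu> by (simp add: p_def)
  have "massart \<mu> z = 9 * (z - \<mu>)\<^sup>2 / (2 * p)"
    using z \<mu> by (simp add: massart_def p_def field_simps)
  with V k p have "k * (z - \<mu>)\<^sup>2 < p" by (simp add: field_simps)
  then have "(4 + k) * (k * (z - \<mu>)\<^sup>2) < (4 + k) * p" using k by simp
  then have "((4 + k) * (\<mu> - z) - 3 * (1 - 2 * z))\<^sup>2 < 9 * D\<^sup>2"
    unfolding D2 p_def by (simp add: algebra_simps power2_eq_square)
  then have "\<bar>(4 + k) * (\<mu> - z) - 3 * (1 - 2 * z)\<bar>\<^sup>2 < (3 * D)\<^sup>2"
    by (simp only: power2_abs power_mult_distrib) simp
  then have bound: "\<bar>(4 + k) * (\<mu> - z) - 3 * (1 - 2 * z)\<bar> < 3 * D"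
    by (rule power2_less_imp_less) (use D0 in simp)
  define q where "q = (\<mu> - z) * (4 + k)"
  have "\<bar>q - 3 * (1 - 2 * z)\<bar> < 3 * D"
    using bound by (simp only: q_def mult.commute)
  then have "3 * (1 - 2 * z - D) < q" "q < 3 * (1 - 2 * z + D)"
    by (simp_all add: abs_less_iff)
  then have "3 * (1 - 2 * z - D) / (4 + k) < \<mu> - z" "\<mu> - z < 3 * (1 - 2 * z + D) / (4 + k)"
    unfolding q_def using k by (simp_all only: pos_divide_less_eq pos_less_divide_eq add_pos_pos zero_less_numeral)
  then show "z + 3 / (4 + k) * (1 - 2 * z - sqrt (1 + k * z * (1 - z))) < \<mu>"
    "\<mu> < z + 3 / (4 + k) * (1 - 2 * z + sqrt (1 + k * z * (1 - z)))"
    unfolding D_def[symmetric] by (simp_all add: algebra_simps)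
qed

section \<open>Chernoff bounds for the upper tail\<close>

lemma (in prob_space) chernoff_sum_ge:
  fixes X :: "'i \<Rightarrow> 'a \<Rightarrow> real"
  assumes fin: "finite I" and indep: "indep_vars (\<lambda>_. borel) X I"
    and bounds: "\<And>i. i \<in> I \<Longrightarrow> AE x in M. X i x \<in> {0..1}"
    and mean: "\<And>i. i \<in> I \<Longrightarrow> expectation (X i) = \<mu>"
    and l: "0 < l"
  shows "prob {x \<in> space M. a \<le> (\<Sum>i\<in>I. X i x)} \<le> exp (- l * a) * (1 - \<mu> + \<mu> * exp l) ^ card I"
proof -
  interpret indep_interval_bounded_random_variables M I X "\<lambda>_. 0" "\<lambda>_. 1"
    by unfold_locales (use fin indep bounds in auto)
  have intX: "integrable M (X i)" if "i \<in> I" for i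
  proof -
    interpret interval_bounded_random_variable M "X i" 0 1
      using that by (rule bounded_random_variable)
    show ?thesis by (rule integrable)
  qed
  have inte: "integrable M (\<lambda>x. exp (l * X i x))" if i: "i \<in> I" for i
  proof (rule integrable_const_bound[where B = "exp l"])
    show "AE x in M. norm (exp (l * X i x)) \<le> exp l"
      using bounds[OF i] by eventually_elim (use l in \<open>auto simp: mult_le_cancel_left2\<close>)
    show "(\<lambda>x. exp (l * X i x)) \<in> borel_measurable M"
      using random_variable[OF i] by measurable
  qed
  \<comment> \<open>The chord bound compares \<open>X i\<close> with a Bernoulli variable of mean
    \<open>\<mu>\<close>, whose moment generating function is the right-hand side.\<close>
  have mgf: "expectation (\<lambda>x. exp (l * X i x)) \<le> 1 - \<mu> + \<mu> * exp l" if i: "i \<in> I" for i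
  proof -
    have "expectation (\<lambda>x. exp (l * X i x)) \<le> expectation (\<lambda>x. 1 - X i x + X i x * exp l)"
    proof (rule integral_mono_AE)
      show "AE x in M. exp (l * X i x) \<le> 1 - X i x + X i x * exp l"
        using bounds[OF i] by eventually_elim (auto intro: exp_le_chord)
    qed (use inte intX i in auto)
    also have "\<dots> = 1 - \<mu> + \<mu> * exp l"
      using intX[OF i] mean[OF i] by (simp add: prob_space)
    finally show ?thesis .
  qed
  have indep': "indep_vars (\<lambda>_. borel) (\<lambda>i x. exp (l * X i x)) I"
    by (rule indep_vars_compose2[OF indep]) auto
  have exp_sum': "exp (l * (\<Sum>i\<in>I. X i x)) = (\<Prod>i\<in>I. exp (l * X i x))" for x
    by (simp add: sum_distrib_left exp_sum fin)
  have int: "integrable M (\<lambda>x. exp (l * (\<Sum>i\<in>I. X i x)))"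
    unfolding exp_sum' by (rule indep_vars_integrable[OF fin indep' inte])
  have "prob {x \<in> space M. a \<le> (\<Sum>i\<in>I. X i x)}
      \<le> exp (- l * a) * (\<integral>x\<in>space M. exp (l * (\<Sum>i\<in>I. X i x)) \<partial>M)"
    by (rule Chernoff_ineq_ge[OF l])
       (use int in \<open>auto simp: set_integrable_def intro!: integrable_mult_indicator[where 'b = real, simplified]\<close>)
  also have "(\<integral>x\<in>space M. exp (l * (\<Sum>i\<in>I. X i x)) \<partial>M) = expectation (\<lambda>x. exp (l * (\<Sum>i\<in>I. X i x)))"
    by (rule set_integral_space[OF int])
  also have "\<dots> = (\<Prod>i\<in>I. expectation (\<lambda>x. exp (l * X i x)))"
    unfolding exp_sum' by (rule indep_vars_lebesgue_integral[OF fin indep' inte])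
  also have "exp (- l * a) * \<dots> \<le> exp (- l * a) * (\<Prod>i\<in>I. 1 - \<mu> + \<mu> * exp l)"
    by (intro mult_left_mono prod_mono) (auto intro: mgf Bochner_Integration.integral_nonneg)
  finally show ?thesis by simp
qed

text \<open>Strictly between \<open>\<mu>\<close> and 1 the optimised Chernoff exponent is the
  divergence, to which \<open>kl_ge_massart\<close> applies. At \<open>z = \<mu>\<close> the bound
  is 1, and \<open>z = 1\<close> is a limiting case.\<close>

lemma (in prob_space) massart_tail:
  fixes X :: "'i \<Rightarrow> 'a \<Rightarrow> real" and z :: real
  assumes fin: "finite I" and indep: "indep_vars (\<lambda>_. borel) X I"
    and bounds: "\<And>i. i \<in> I \<Longrightarrow> AE x in M. X i x \<in> {0..1}"
    and mean: "\<And>i. i \<in> I \<Longrightarrow> expectation (X i) = \<mu>"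
    and \<mu>: "0 < \<mu>" "\<mu> < 1" and z: "\<mu> \<le> z" "z \<le> 1"
  shows "prob {x \<in> space M. card I * z \<le> (\<Sum>i\<in>I. X i x)} \<le> exp (- (card I * massart \<mu> z))"
proof -
  have [measurable]: "X i \<in> borel_measurable M" if "i \<in> I" for i
    using indep that by (auto simp: indep_vars_def)
  have interior: "prob {x \<in> space M. card I * y \<le> (\<Sum>i\<in>I. X i x)} \<le> exp (- (card I * massart \<mu> y))"
    if y: "\<mu> < y" "y < 1" for y :: real
  proof -
    \<comment> \<open>the minimiser of the Chernoff bound, for which the exponent is the divergence\<close>
    define l where "l = ln (y / \<mu>) - ln ((1 - y) / (1 - \<mu>))"
    have ratio: "(1 - \<mu>) / (1 - y) > 0" "y / \<mu> > 0" "(1 - y) / (1 - \<mu>) > 0" using \<mu> y by simp_all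
    have "(1 - y) / (1 - \<mu>) < y / \<mu>" using \<mu> y by (simp add: field_simps)
    then have l: "l > 0" using ratio by (simp add: l_def)
    have "exp l = (y / \<mu>) / ((1 - y) / (1 - \<mu>))" using ratio by (simp add: l_def exp_diff)
    then have "1 - \<mu> + \<mu> * exp l = (1 - \<mu>) / (1 - y)" using \<mu> y by (simp add: field_simps)
    also have "\<dots> = exp (- ln ((1 - y) / (1 - \<mu>)))"
      using ratio by (simp add: exp_minus)
    finally have base: "1 - \<mu> + \<mu> * exp l = exp (- ln ((1 - y) / (1 - \<mu>)))" .
    have "prob {x \<in> space M. card I * y \<le> (\<Sum>i\<in>I. X i x)}
        \<le> exp (- l * (card I * y)) * (1 - \<mu> + \<mu> * exp l) ^ card I"
      by (rule chernoff_sum_ge[OF fin indep bounds mean l])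
    also have "\<dots> = exp (- (card I * (y * ln (y / \<mu>) + (1 - y) * ln ((1 - y) / (1 - \<mu>)))))"
      unfolding base exp_of_nat_mult[symmetric] exp_add[symmetric]
      by (simp add: l_def algebra_simps)
    also have "\<dots> \<le> exp (- (card I * massart \<mu> y))"
      using kl_ge_massart[OF \<mu>(1) y] by (simp add: mult_left_mono)
    finally show ?thesis .
  qed
  consider "z = \<mu>" | "\<mu> < z" "z < 1" | "z = 1" using z by linarith
  then show ?thesis
  proof cases
    case 1
    then show ?thesis by (simp add: massart_def)
  next
    case 2
    then show ?thesis by (rule interior)
  next
    case 3
    \<comment> \<open>the optimal \<open>l\<close> is infinite at \<open>z = 1\<close>, so pass to the limit from the left\<close>
    have "((\<lambda>y. exp (- (card I * massart \<mu> y))) \<longlongrightarrow> exp (- (card I * massart \<mu> 1))) (at_left 1)"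
      unfolding massart_def using \<mu> by (intro tendsto_intros) auto
    moreover have "eventually (\<lambda>y. \<mu> < y \<and> y < 1) (at_left (1::real))"
      using eventually_at_left_real[OF \<mu>(2)] by eventually_elim auto
    then have "eventually (\<lambda>y. prob {x \<in> space M. card I * z \<le> (\<Sum>i\<in>I. X i x)}
        \<le> exp (- (card I * massart \<mu> y))) (at_left 1)"
    proof eventually_elim
      case (elim y)
      have "card I * y \<le> card I * z" using elim 3 by (intro mult_left_mono) auto
      then have "prob {x \<in> space M. card I * z \<le> (\<Sum>i\<in>I. X i x)}
          \<le> prob {x \<in> space M. card I * y \<le> (\<Sum>i\<in>I. X i x)}"
        by (intro finite_measure_mono) auto
      then show ?case using interior[of y] elim by simp
    qed
    ultimately show ?thesis using 3 by (auto intro: tendsto_lowerbound)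
  qed
qed

text \<open>Whether the limits enclose \<open>\<mu>\<close> is governed by the value of
  \<open>massart\<close>, so the threshold \<open>t\<close> is put on that value. Keeping
  \<open>Y\<close> as a parameter lets the lemma serve also for \<open>1 - Y x\<close>, the mean of
  the \<open>1 - X i\<close>.\<close>

lemma (in prob_space) massart_deviation:
  fixes X :: "'i \<Rightarrow> 'a \<Rightarrow> real" and t :: real
  assumes fin: "finite I" and ne: "I \<noteq> {}" and indep: "indep_vars (\<lambda>_. borel) X I"
    and bounds: "\<And>i. i \<in> I \<Longrightarrow> AE x in M. X i x \<in> {0..1}"
    and mean: "\<And>i. i \<in> I \<Longrightarrow> expectation (X i) = \<mu>"
    and \<mu>: "0 < \<mu>" "\<mu> < 1"
    and Y: "\<And>x. Y x = (\<Sum>i\<in>I. X i x) / card I"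
  shows "prob {x \<in> space M. \<mu> \<le> Y x \<and> Y x \<le> 1 \<and> t \<le> massart \<mu> (Y x)} \<le> exp (- (card I * t))"
proof -
  have [measurable]: "X i \<in> borel_measurable M" if "i \<in> I" for i
    using indep that by (auto simp: indep_vars_def)
  \<comment> \<open>the least element of the closed set \<open>S\<close> turns the event into a one-sided tail\<close>
  define S where "S = {z \<in> {\<mu>..1}. t \<le> massart \<mu> z}"
  show ?thesis
  proof (cases "S = {}")
    case True
    then have "{x \<in> space M. \<mu> \<le> Y x \<and> Y x \<le> 1 \<and> t \<le> massart \<mu> (Y x)} = {}"
      by (auto simp: S_def)
    then show ?thesis by (simp only: measure_empty exp_ge_zero)
  next
    case False
    have "closed S"
      unfolding S_def
      by (intro continuous_on_closed_Collect_le continuous_on_massart \<mu> continuous_intros closed_atLeastAtMost)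
    then have "compact S"
      by (rule compact_eq_bounded_closed[THEN iffD2, OF conjI, rotated])
         (auto simp: S_def intro: bounded_subset[OF bounded_closed_interval[of \<mu> 1]])
    then obtain z where z: "z \<in> S" and least: "\<And>y. y \<in> S \<Longrightarrow> z \<le> y"
      using compact_attains_inf[OF _ False] by blast
    have c: "0 < real (card I)" using fin ne by (simp add: card_gt_0_iff)
    have "{x \<in> space M. \<mu> \<le> Y x \<and> Y x \<le> 1 \<and> t \<le> massart \<mu> (Y x)}
        \<subseteq> {x \<in> space M. card I * z \<le> (\<Sum>i\<in>I. X i x)}"
    proof safe
      fix x assume "\<mu> \<le> Y x" "Y x \<le> 1" "t \<le> massart \<mu> (Y x)"
      then have "z \<le> Y x" by (intro least) (simp add: S_def)
      then show "card I * z \<le> (\<Sum>i\<in>I. X i x)" using c by (simp add: Y field_simps)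
    qed
    then have "prob {x \<in> space M. \<mu> \<le> Y x \<and> Y x \<le> 1 \<and> t \<le> massart \<mu> (Y x)}
        \<le> prob {x \<in> space M. card I * z \<le> (\<Sum>i\<in>I. X i x)}"
      by (intro finite_measure_mono) auto
    also have "\<dots> \<le> exp (- (card I * massart \<mu> z))"
      using z by (intro massart_tail[OF fin indep bounds mean \<mu>]) (auto simp: S_def)
    also have "\<dots> \<le> exp (- (card I * t))"
      using z by (auto simp: S_def mult_left_mono)
    finally show ?thesis .
  qed
qed

section \<open>Coverage probability by a union bound over the two tails\<close>

theorem theorem1:
  fixes M :: "'a measure" and Z :: "'a \<Rightarrow> real" and X :: "nat \<Rightarrow> 'a \<Rightarrow> real"
    and n :: nat and \<delta> \<mu> :: real
  assumes "prob_space M"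
    and "0 < \<delta>" and "\<delta> < 1"
    and "Z \<in> borel_measurable M"
    and "measure M {\<omega> \<in> space M. 0 \<le> Z \<omega> \<and> Z \<omega> \<le> 1} = 1"
    and "\<mu> = integral\<^sup>L M Z"
    and "0 < \<mu>" and "\<mu> < 1"
    and "0 < n"
    and "prob_space.indep_vars M (\<lambda>_. borel) X {1..n}"
    and "\<forall>i \<in> {1..n}. distr M borel (X i) = distr M borel Z"
  shows "measure M {\<omega> \<in> space M.
           lower_limit \<delta> n (sample_mean n X \<omega>) < \<mu> \<and>
           \<mu> < upper_limit \<delta> n (sample_mean n X \<omega>)} \<ge> 1 - \<delta>"
proof -
  interpret prob_space M by fact
  note [measurable] = \<open>Z \<in> borel_measurable M\<close>
  note indep = \<open>prob_space.indep_vars M (\<lambda>_. borel) X {1..n}\<close>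
  note \<mu> = \<open>0 < \<mu>\<close> \<open>\<mu> < 1\<close>
  have Xm [measurable]: "X i \<in> borel_measurable M" if "i \<in> {1..n}" for i
    using indep that by (auto simp: indep_vars_def)
  have "AE x in M. x \<in> {\<omega> \<in> space M. 0 \<le> Z \<omega> \<and> Z \<omega> \<le> 1}"
    using assms(5) by (intro AE_prob_1)
  then have Z: "AE x in M. Z x \<in> {0..1}" by eventually_elim auto
  \<comment> \<open>Range and mean depend only on the distribution, so both pass from
    \<open>Z\<close> to each \<open>X i\<close>.\<close>
  have bounds: "AE x in M. X i x \<in> {0..1}" if i: "i \<in> {1..n}" for i
  proof -
    have "AE z in distr M borel Z. z \<in> {0..1}"
      using Z by (subst AE_distr_iff) auto
    then have "AE z in distr M borel (X i). z \<in> {0..1}" using assms(11) i by metis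
    then show ?thesis using Xm[OF i] by (subst (asm) AE_distr_iff) auto
  qed
  have mean: "expectation (X i) = \<mu>" if i: "i \<in> {1..n}" for i
  proof -
    have "expectation (X i) = integral\<^sup>L (distr M borel (X i)) (\<lambda>x. x)"
      using Xm[OF i] by (subst integral_distr) auto
    also have "\<dots> = expectation Z"
      using assms(11) i by (simp add: integral_distr)
    finally show ?thesis using assms(6) by simp
  qed
  have intX: "integrable M (X i)" if i: "i \<in> {1..n}" for i
  proof (rule integrable_const_bound[where B = 1])
    show "AE x in M. norm (X i x) \<le> 1" using bounds[OF i] by eventually_elim auto
  qed (use Xm[OF i] in auto)
  \<comment> \<open>This \<open>t\<close> gives each tail probability at most
    \<open>\<delta> / 2\<close>, and it equals the threshold \<open>9 / (2 * k)\<close> of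
    \<open>limits_contain\<close>.\<close>
  define t where "t = ln (2 / \<delta>) / n"
  define Y where "Y = sample_mean n X"
  have Ym [measurable]: "Y \<in> borel_measurable M"
    unfolding Y_def sample_mean_def[abs_def] by measurable
  define A where "A = {x \<in> space M. \<mu> \<le> Y x \<and> Y x \<le> 1 \<and> t \<le> massart \<mu> (Y x)}"
  define B where "B = {x \<in> space M. 1 - \<mu> \<le> 1 - Y x \<and> 1 - Y x \<le> 1 \<and> t \<le> massart (1 - \<mu>) (1 - Y x)}"
  define G where "G = {\<omega> \<in> space M. lower_limit \<delta> n (sample_mean n X \<omega>) < \<mu> \<and>
           \<mu> < upper_limit \<delta> n (sample_mean n X \<omega>)}"
  have L: "0 < ln (2 / \<delta>)" using assms(2,3) by simp
  have tail: "exp (- (card {1..n} * t)) = \<delta> / 2"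
    using assms(2,9) by (simp add: t_def exp_minus)
  have PA: "prob A \<le> \<delta> / 2"
    unfolding A_def tail[symmetric] using assms(9)
    by (intro massart_deviation[OF _ _ indep bounds mean \<mu>]) (auto simp: Y_def sample_mean_def)
  have PB: "prob B \<le> \<delta> / 2"
    unfolding B_def tail[symmetric]
  proof (rule massart_deviation[where X = "\<lambda>i x. 1 - X i x"])
    show "indep_vars (\<lambda>_. borel) (\<lambda>i x. 1 - X i x) {1..n}"
      by (rule indep_vars_compose2[OF indep]) auto
    show "AE x in M. 1 - X i x \<in> {0..1}" if "i \<in> {1..n}" for i
      using bounds[OF that] by eventually_elim auto
    show "expectation (\<lambda>x. 1 - X i x) = 1 - \<mu>" if "i \<in> {1..n}" for i
      using intX[OF that] mean[OF that] by (simp add: prob_space)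
    show "1 - Y x = (\<Sum>i\<in>{1..n}. 1 - X i x) / card {1..n}" for x
      using assms(9) by (simp add: Y_def sample_mean_def sum_subtractf diff_divide_distrib)
  qed (use \<mu> assms(9) in auto)
  have meas [measurable]: "A \<in> sets M" "B \<in> sets M" "G \<in> sets M"
    unfolding A_def B_def G_def massart_def lower_limit_def upper_limit_def Y_def[symmetric]
    by measurable
  have "AE x in M. \<forall>i\<in>{1..n}. X i x \<in> {0..1}"
    using bounds by (intro AE_finite_allI) auto
  then have "AE x in M. x \<in> space M \<longrightarrow> x \<in> A \<union> B \<union> G"
  proof eventually_elim
    case (elim x)
    have "0 \<le> (\<Sum>i=1..n. X i x)" using elim by (intro sum_nonneg) auto
    moreover have "(\<Sum>i=1..n. X i x) \<le> (\<Sum>i=1..n. 1)" using elim by (intro sum_mono) auto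
    ultimately have Y01: "0 \<le> Y x" "Y x \<le> 1" using assms(9) by (auto simp: Y_def sample_mean_def)
    have "x \<in> G" if x: "x \<in> space M" and "massart \<mu> (Y x) < t"
    proof -
      have k: "0 < n * ci_const \<delta>" using L assms(9) by (simp add: ci_const_def)
      have "t = 9 / (2 * (n * ci_const \<delta>))" using L assms(9) by (simp add: t_def ci_const_def)
      then show ?thesis
        using limits_contain[OF k Y01 \<mu>] that
        unfolding G_def lower_limit_def upper_limit_def Y_def by simp
    qed
    \<comment> \<open>If \<open>massart \<mu> (Y x)\<close> is at least \<open>t\<close>, then
      \<open>x\<close> lies in \<open>A\<close> or \<open>B\<close> according to the side of
      \<open>\<mu>\<close> on which \<open>Y x\<close> falls.\<close>
    then show ?case using Y01 by (auto simp: A_def B_def massart_flip not_le[symmetric])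
  qed
  then have "1 \<le> prob (A \<union> B \<union> G)"
    by (intro order.eq_iff[THEN iffD1, THEN conjunct1] prob_eq_1[THEN iffD2, symmetric]) auto
  also have "\<dots> \<le> prob (A \<union> B) + prob G" by (rule measure_Un_le) auto
  also have "prob (A \<union> B) \<le> prob A + prob B" by (rule measure_Un_le) auto
  finally show ?thesis using PA PB unfolding G_def[symmetric] by simp
qed

end
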